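(* Let $(L,\leq)$ be a complete lattice. (1) If $L$ is a well-separated $\kappa$-lattice, then $L$ is left modular if and only if $L$ is extremal. (2) If $L$ is weakly atomic and completely semidistributive, then $L$ is left modular if and only if $L$ is extremal.
   Context: Lattices are complete and possibly infinite. An element $x\neq\bigvee\emptyset$ is completely join-irreducible if $x\neq\bigvee S$ for every $S\subseteq\{y\in L\mid y<x\}$; then $x_*:=\bigvee\{y\mid y<x\}$ is its unique lower cover. Completely meet-irreducible elements $m$, and $m^*$, are defined dually. $\mathrm{JI}^c(L)$ and $\mathrm{MI}^c(L)$ denote the sets of completely join-irreducible and completely meet-irreducible elements. $L$ is bi-spatial if every element is a join of elements of $\mathrm{JI}^c(L)$ and also a meet of elements of $\mathrm{MI}^c(L)$. We write $x\lessdot y$ for a cover relation. A bi-spatial lattice $L$ is a $\kappa$-lattice if there are mutually inverse bijections $\kappa:\mathrm{JI}^c(L)\to\mathrm{MI}^c(L)$ and $\kappa^{-1}:\mathrm{MI}^c(L)\to\mathrm{JI}^c(L)$ given by $\kappa(j)=\max\{x\in L\mid x\wedge j=j_*\}$ and $\kappa^{-1}(m)=\min\{y\in L\mid y\vee m=m^*\}$ (in particular these maxima and minima exist). A $\kappa$-lattice is well-separated if whenever $x\not\leq y$ there is $j\in\mathrm{JI}^c(L)$ with $j\leq x$ and $y\leq\kappa(j)$. $L$ is weakly atomic if for all $x<y$ there are $u,v$ with $x\leq u\lessdot v\leq y$. $L$ is completely semidistributive if for all $x\in L$, $S\subseteq L$: if $x\vee y=x\vee z$ for all $y,z\in S$ then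 $x\vee\bigwedge S=x\vee y$ for all $y\in S$; and dually, if $x\wedge y=x\wedge z$ for all $y,z\in S$ then $x\wedge\bigvee S=x\wedge y$ for all $y\in S$. (A known fact: weakly atomic completely semidistributive lattices are $\kappa$-lattices.) An element $x\in L$ is left modular if $(y\vee x)\wedge z=y\vee(x\wedge z)$ for all $y\leq z$ in $L$. The lattice $L$ is left modular if it has an inclusion-maximal chain all of whose elements are left modular. A maximal chain $\mathcal X$ in $L$ is $\lambda$-extremal, for a bijection $\lambda:\mathrm{JI}^c(L)\to\mathrm{MI}^c(L)$, if: for every $x\in\mathcal X$ and $j\in\mathrm{JI}^c(L)$ with $j\not\leq x$ we have $x\leq\lambda(j)$; and whenever $x\lessdot y$ with $x,y\in\mathcal X$, there is a unique $j\in\mathrm{JI}^c(L)$ with $j\leq y$, $j\not\leq x$, there is a unique $m\in\mathrm{MI}^c(L)$ with $x\leq m$, $y\not\leq m$, and $\lambda(j)=m$. $L$ is extremal if it admits a $\lambda$-extremal chain for some bijection $\lambda$; by convention, if $L$ is a $\kappa$-lattice then $\lambda=\kappa$ is taken. *)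

theory Defs
  imports Main
begin

text \<open>The lattice \<open>L\<close> is a type \<open>'a\<close> of class \<^class>\<open>complete_lattice\<close>; properties of \<open>L\<close> as a
  whole are predicates on \<^term>\<open>TYPE('a)\<close>.\<close>

definition covers :: "'a::order \<Rightarrow> 'a \<Rightarrow> bool" where
  "covers x y \<longleftrightarrow> x < y \<and> \<not> (\<exists>z. x < z \<and> z < y)"

definition JIc :: "'a::complete_lattice set" where
  "JIc = {x. x \<noteq> Sup {} \<and> (\<forall>S. S \<subseteq> {y. y < x} \<longrightarrow> x \<noteq> Sup S)}"

definition MIc :: "'a::complete_lattice set" where
  "MIc = {x. x \<noteq> Inf {} \<and> (\<forall>S. S \<subseteq> {y. x < y} \<longrightarrow> x \<noteq> Inf S)}"

text \<open>\<open>j\<^sub>*\<close> and \<open>m\<^sup>*\<close>; only meaningful for \<open>j \<in> JIc\<close> and \<open>m \<in> MIc\<close>.\<close>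

definition lower_star :: "'a::complete_lattice \<Rightarrow> 'a" where
  "lower_star j = Sup {y. y < j}"

definition upper_star :: "'a::complete_lattice \<Rightarrow> 'a" where
  "upper_star m = Inf {y. m < y}"

definition bi_spatial :: "'a::complete_lattice itself \<Rightarrow> bool" where
  "bi_spatial TYPE('a) \<longleftrightarrow>
     (\<forall>x::'a. (\<exists>S. S \<subseteq> JIc \<and> x = Sup S) \<and> (\<exists>S. S \<subseteq> MIc \<and> x = Inf S))"

text \<open>If the maximum (minimum) does not exist, the value is unspecified; existence is
  required separately in \<open>kappa_lattice\<close>.\<close>

definition kappa :: "'a::complete_lattice \<Rightarrow> 'a" where
  "kappa j = (GREATEST x. inf x j = lower_star j)"

definition kappa_inv :: "'a::complete_lattice \<Rightarrow> 'a" where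
  "kappa_inv m = (LEAST y. sup y m = upper_star m)"

definition kappa_lattice :: "'a::complete_lattice itself \<Rightarrow> bool" where
  "kappa_lattice TYPE('a) \<longleftrightarrow>
     bi_spatial TYPE('a) \<and>
     (\<forall>j\<in>(JIc :: 'a set). \<exists>x. inf x j = lower_star j \<and>
        (\<forall>y. inf y j = lower_star j \<longrightarrow> y \<le> x)) \<and>
     (\<forall>m\<in>(MIc :: 'a set). \<exists>y. sup y m = upper_star m \<and>
        (\<forall>z. sup z m = upper_star m \<longrightarrow> y \<le> z)) \<and>
     bij_betw kappa (JIc :: 'a set) MIc \<and>
     bij_betw kappa_inv (MIc :: 'a set) JIc \<and>
     (\<forall>j\<in>(JIc :: 'a set). kappa_inv (kappa j) = j) \<and>
     (\<forall>m\<in>(MIc :: 'a set). kappa (kappa_inv m) = m)"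

definition well_separated_kappa_lattice :: "'a::complete_lattice itself \<Rightarrow> bool" where
  "well_separated_kappa_lattice TYPE('a) \<longleftrightarrow>
     kappa_lattice TYPE('a) \<and>
     (\<forall>x y :: 'a. \<not> x \<le> y \<longrightarrow> (\<exists>j\<in>JIc. j \<le> x \<and> y \<le> kappa j))"

definition weakly_atomic :: "'a::complete_lattice itself \<Rightarrow> bool" where
  "weakly_atomic TYPE('a) \<longleftrightarrow>
     (\<forall>x y :: 'a. x < y \<longrightarrow> (\<exists>u v. x \<le> u \<and> covers u v \<and> v \<le> y))"

definition completely_semidistributive :: "'a::complete_lattice itself \<Rightarrow> bool" where
  "completely_semidistributive TYPE('a) \<longleftrightarrow>
     (\<forall>(x::'a) S.
        ((\<forall>y\<in>S. \<forall>z\<in>S. sup x y = sup x z) \<longrightarrow> (\<forall>y\<in>S. sup x (Inf S) = sup x y)) \<and>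
        ((\<forall>y\<in>S. \<forall>z\<in>S. inf x y = inf x z) \<longrightarrow> (\<forall>y\<in>S. inf x (Sup S) = inf x y)))"

definition left_modular_element :: "'a::complete_lattice \<Rightarrow> bool" where
  "left_modular_element x \<longleftrightarrow> (\<forall>y z. y \<le> z \<longrightarrow> inf (sup y x) z = sup y (inf x z))"

abbreviation maximal_chain :: "'a::complete_lattice set \<Rightarrow> bool" where
  "maximal_chain X \<equiv> pred_on.maxchain UNIV (\<le>) X"

definition left_modular :: "'a::complete_lattice itself \<Rightarrow> bool" where
  "left_modular TYPE('a) \<longleftrightarrow>
     (\<exists>X :: 'a set. maximal_chain X \<and> (\<forall>x\<in>X. left_modular_element x))"

definition extremal_chain :: "('a::complete_lattice \<Rightarrow> 'a) \<Rightarrow> 'a set \<Rightarrow> bool" where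
  "extremal_chain l X \<longleftrightarrow>
     maximal_chain X \<and>
     (\<forall>x\<in>X. \<forall>j\<in>JIc. \<not> j \<le> x \<longrightarrow> x \<le> l j) \<and>
     (\<forall>x\<in>X. \<forall>y\<in>X. covers x y \<longrightarrow>
        (\<exists>!j. j \<in> JIc \<and> j \<le> y \<and> \<not> j \<le> x) \<and>
        (\<exists>!m. m \<in> MIc \<and> x \<le> m \<and> \<not> y \<le> m) \<and>
        (\<forall>j m. j \<in> JIc \<and> j \<le> y \<and> \<not> j \<le> x \<longrightarrow> m \<in> MIc \<and> x \<le> m \<and> \<not> y \<le> m \<longrightarrow> l j = m))"

text \<open>On a \<open>\<kappa>\<close>-lattice the bijection is by convention required to be \<open>\<kappa>\<close>.
  The values of \<open>l\<close> outside \<open>JIc\<close> are irrelevant.\<close>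

definition extremal :: "'a::complete_lattice itself \<Rightarrow> bool" where
  "extremal TYPE('a) \<longleftrightarrow>
     (\<exists>l. bij_betw l (JIc :: 'a set) MIc \<and>
          (kappa_lattice TYPE('a) \<longrightarrow> (\<forall>j\<in>JIc. l j = kappa j)) \<and>
          (\<exists>X. extremal_chain l X))"

end

theory Submission imports Defs begin

text \<open>
  Everything rests on one local criterion. In a \<open>\<kappa>\<close>-lattice, a left modular element \<open>x\<close>
  satisfies, for every completely join-irreducible \<open>j\<close>, the dichotomy
  \<open>j \<le> x\<close> or \<open>x \<le> \<kappa>(j)\<close>, which is the first half of extremality: apply modularity to
  the cover \<open>j\<^sub>* < j\<close> and use that \<open>\<kappa>(j)\<close> is a maximum. Conversely, a failure
  \<open>y \<squnion> (x \<sqinter> z) < (y \<squnion> x) \<sqinter> z\<close> of modularity contradicts the dichotomy as soon as some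
  \<open>j\<close> lies below the right side while \<open>\<kappa>(j)\<close> lies above the left side. What the converse
  uses is thus the separation of comparable elements, and this is common to both parts:
  a weakly atomic, completely semidistributive lattice is a \<open>\<kappa>\<close>-lattice in which any two
  comparable elements are separated, because weak atomicity puts a cover \<open>u \<lessdot> v\<close> between them and
  the least \<open>j\<close> with \<open>j \<squnion> u = v\<close> has \<open>j \<le> v\<close> and \<open>u \<le> \<kappa>(j)\<close>.

  It remains to see that the dichotomy along a maximal chain already forces the condition on
  covers \<open>x \<lessdot> y\<close>. If \<open>j \<le> y\<close> and \<open>j \<not>\<le> x\<close>, then \<open>x \<squnion> j = y\<close> and \<open>x \<le> \<kappa>(j)\<close>, so
  \<open>\<kappa>(j) \<squnion> y = \<kappa>(j)\<^sup>*\<close>. This join is the same for every other candidate \<open>j'\<close>, and the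
  minimality of \<open>j = \<kappa>\<^sup>-\<^sup>1(\<kappa>(j))\<close> then gives \<open>j \<le> j'\<close>; by symmetry \<open>j = j'\<close>. A
  completely meet-irreducible \<open>m\<close> with \<open>x \<le> m\<close> and \<open>y \<not>\<le> m\<close> is \<open>\<kappa>\<close> of such a \<open>j\<close>.
\<close>

section \<open>Irreducible elements and their unique covers\<close>

lemma lower_star_less: "j \<in> JIc \<Longrightarrow> lower_star j < j"
  unfolding JIc_def lower_star_def
  by (metis (mono_tags, lifting) Sup_least mem_Collect_eq order_le_less subset_refl)

lemma le_lower_star: "w < j \<Longrightarrow> w \<le> lower_star j"
  unfolding lower_star_def by (simp add: Sup_upper)

lemma less_upper_star: "m \<in> MIc \<Longrightarrow> m < upper_star m"
  unfolding MIc_def upper_star_def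
  by (metis (mono_tags, lifting) Inf_greatest mem_Collect_eq order_le_less subset_refl)

lemma upper_star_le: "m < w \<Longrightarrow> upper_star m \<le> w"
  unfolding upper_star_def by (simp add: Inf_lower)

text \<open>Any element that separates \<open>j\<close> from everything strictly below it witnesses that \<open>j\<close> is
  completely join-irreducible. This is how irreducibles arise from covers.\<close>

lemma JIc_if_separated:
  assumes "\<not> j \<le> u" and "\<And>w. w < j \<Longrightarrow> w \<le> u"
  shows "j \<in> JIc"
proof -
  have "Sup S \<le> u" if "S \<subseteq> {y. y < j}" for S
    using that assms(2) by (auto intro!: Sup_least)
  then show ?thesis
    using assms(1) by (auto simp: JIc_def)
qed

lemma MIc_if_separated:
  assumes "\<not> v \<le> m" and "\<And>w. m < w \<Longrightarrow> v \<le> w"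
  shows "m \<in> MIc"
proof -
  have "v \<le> Inf S" if "S \<subseteq> {y. m < y}" for S
    using that assms(2) by (auto intro!: Inf_greatest)
  then show ?thesis
    using assms(1) by (auto simp: MIc_def)
qed

lemma covers_lower_star: "j \<in> JIc \<Longrightarrow> covers (lower_star j) j"
  unfolding covers_def using lower_star_less le_lower_star leD by blast

lemma covers_upper_star: "m \<in> MIc \<Longrightarrow> covers m (upper_star m)"
  unfolding covers_def using less_upper_star upper_star_le leD by blast

lemma inf_eq_lower_starI:
  assumes "\<not> j \<le> u" and "lower_star j \<le> u" and "j \<in> JIc"
  shows "inf u j = lower_star j"
proof (rule order.antisym)
  have "inf u j < j"
    using assms(1) by (metis inf_le1 inf_le2 order_le_less)
  then show "inf u j \<le> lower_star j"
    by (rule le_lower_star)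
  show "lower_star j \<le> inf u j"
    using assms(2) lower_star_less[OF assms(3)] by simp
qed

lemma kappa_eqI:
  assumes "inf k j = lower_star j" and "\<And>y. inf y j = lower_star j \<Longrightarrow> y \<le> k"
  shows "kappa j = k"
  unfolding kappa_def using assms by (rule Greatest_equality)

lemma kappa_inv_eqI:
  assumes "sup k m = upper_star m" and "\<And>y. sup y m = upper_star m \<Longrightarrow> k \<le> y"
  shows "kappa_inv m = k"
  unfolding kappa_inv_def using assms by (rule Least_equality)

section \<open>Left modularity and extremality in \<open>\<kappa>\<close>-lattices\<close>

context
  assumes kappa_lattice: "kappa_lattice TYPE('a::complete_lattice)"
begin

lemma kappa_inf:
  assumes "(j::'a) \<in> JIc"
  shows "inf (kappa j) j = lower_star j"
  using kappa_lattice assms unfolding kappa_lattice_def by (metis kappa_eqI)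

lemma le_kappa:
  assumes "(j::'a) \<in> JIc" and "inf y j = lower_star j"
  shows "y \<le> kappa j"
  using kappa_lattice assms unfolding kappa_lattice_def by (metis kappa_eqI)

lemma kappa_inv_sup:
  assumes "(m::'a) \<in> MIc"
  shows "sup (kappa_inv m) m = upper_star m"
  using kappa_lattice assms unfolding kappa_lattice_def by (metis kappa_inv_eqI)

lemma kappa_inv_le:
  assumes "(m::'a) \<in> MIc" and "sup y m = upper_star m"
  shows "kappa_inv m \<le> y"
  using kappa_lattice assms unfolding kappa_lattice_def by (metis kappa_inv_eqI)

lemma kappa_bij: "bij_betw kappa (JIc :: 'a set) MIc"
  using kappa_lattice unfolding kappa_lattice_def by blast

lemma kappa_in_MIc: "(j::'a) \<in> JIc \<Longrightarrow> kappa j \<in> MIc"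
  using kappa_bij bij_betwE by blast

lemma kappa_inv_in_JIc: "(m::'a) \<in> MIc \<Longrightarrow> kappa_inv m \<in> JIc"
  using kappa_lattice unfolding kappa_lattice_def by (blast dest: bij_betwE)

lemma kappa_inv_kappa: "(j::'a) \<in> JIc \<Longrightarrow> kappa_inv (kappa j) = j"
  using kappa_lattice unfolding kappa_lattice_def by blast

lemma kappa_kappa_inv: "(m::'a) \<in> MIc \<Longrightarrow> kappa (kappa_inv m) = m"
  using kappa_lattice unfolding kappa_lattice_def by blast

lemma not_le_kappa: "(j::'a) \<in> JIc \<Longrightarrow> \<not> j \<le> kappa j"
  by (metis inf.absorb2 kappa_inf less_irrefl lower_star_less)

lemma exists_JIc_le_not_le:
  assumes "\<not> y \<le> (x::'a)"
  shows "\<exists>j\<in>JIc. j \<le> y \<and> \<not> j \<le> x"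
proof -
  obtain S where "S \<subseteq> JIc" "y = Sup S"
    using kappa_lattice unfolding kappa_lattice_def bi_spatial_def by metis
  then show ?thesis
    using assms by (metis Sup_least Sup_upper subsetD)
qed

text \<open>Modularity at the pair \<open>j\<^sub>* \<le> j\<close> gives \<open>(j\<^sub>* \<squnion> x) \<sqinter> j = j\<^sub>*\<close>, that is,
  \<open>j\<^sub>* \<squnion> x\<close> competes for the maximum \<open>\<kappa>(j)\<close>.\<close>

lemma left_modular_element_imp_le_kappa:
  assumes "left_modular_element x" and "(j::'a) \<in> JIc" and "\<not> j \<le> x"
  shows "x \<le> kappa j"
proof -
  have "inf x j < j"
    using assms(3) by (metis inf_le1 inf_le2 order_le_less)
  then have "inf x j \<le> lower_star j"
    by (rule le_lower_star)
  moreover have "inf (sup (lower_star j) x) j = sup (lower_star j) (inf x j)"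
    using assms(1) lower_star_less[OF assms(2)] unfolding left_modular_element_def by simp
  ultimately have "inf (sup (lower_star j) x) j = lower_star j"
    by (simp add: sup_absorb1)
  then show ?thesis
    using le_kappa[OF assms(2)] by (metis le_supE)
qed

text \<open>The separating \<open>j\<close> lies below \<open>(y \<squnion> x) \<sqinter> z\<close>, with \<open>\<kappa>(j)\<close> above \<open>y \<squnion> (x \<sqinter> z)\<close>.
  Either alternative of the dichotomy puts \<open>j\<close> below \<open>\<kappa>(j)\<close>: through \<open>x \<sqinter> z\<close> if
  \<open>j \<le> x\<close>, through \<open>y \<squnion> x\<close> if \<open>x \<le> \<kappa>(j)\<close>.\<close>

lemma left_modular_elementI_kappa:
  assumes separated: "\<And>x y :: 'a. x < y \<Longrightarrow> \<exists>j\<in>JIc. j \<le> y \<and> x \<le> kappa j"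
    and dichotomy: "\<And>j. j \<in> JIc \<Longrightarrow> \<not> j \<le> x \<Longrightarrow> x \<le> kappa j"
  shows "left_modular_element (x::'a)"
  unfolding left_modular_element_def
proof (intro allI impI)
  fix y z :: 'a
  assume "y \<le> z"
  then have le: "sup y (inf x z) \<le> inf (sup y x) z"
    by (simp add: le_infI1 le_supI2)
  show "inf (sup y x) z = sup y (inf x z)"
  proof (rule ccontr)
    assume "\<not> ?thesis"
    then obtain j where j: "j \<in> JIc" "j \<le> inf (sup y x) z" "sup y (inf x z) \<le> kappa j"
      using separated le by (metis order_le_less)
    show False
    proof (cases "j \<le> x")
      case True
      then have "j \<le> kappa j"
        using j(2,3) by (meson le_inf_iff le_sup_iff order_trans)
      then show False
        using not_le_kappa j(1) by blast
    next
      case False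
      then have "sup y x \<le> kappa j"
        using dichotomy j(1,3) by simp
      then have "j \<le> kappa j"
        using j(2) by (meson le_inf_iff order_trans)
      then show False
        using not_le_kappa j(1) by blast
    qed
  qed
qed

text \<open>Within a cover \<open>x \<lessdot> y\<close> both \<open>j\<close> and \<open>j'\<close> join with \<open>x\<close> to \<open>y\<close>, hence they have the same
  join with \<open>\<kappa>(j) \<ge> x\<close>. This join is \<open>\<kappa>(j)\<^sup>*\<close>, and \<open>j\<close> is the least element reaching it.\<close>

lemma JIc_label_le:
  assumes "covers x y" and "(j::'a) \<in> JIc" and "x \<le> kappa j"
    and "j \<le> y" "\<not> j \<le> x" and "j' \<le> y" "\<not> j' \<le> x"
  shows "j \<le> j'"
proof -
  have join: "sup x i = y" if "i \<le> y" "\<not> i \<le> x" for i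
    using assms(1) that unfolding covers_def
    by (metis le_sup_iff order_le_less sup.cobounded1 sup.cobounded2)
  have "sup j' (kappa j) = sup (sup x j') (kappa j)"
    using assms(3) by (simp add: sup.absorb2 sup.commute sup.left_commute)
  also have "\<dots> = sup (sup x j) (kappa j)"
    using join assms by simp
  also have "\<dots> = sup j (kappa j)"
    using assms(3) by (simp add: sup.absorb2 sup.commute sup.left_commute)
  also have "\<dots> = upper_star (kappa j)"
    using kappa_inv_sup[OF kappa_in_MIc] kappa_inv_kappa assms(2) by metis
  finally show ?thesis
    using kappa_inv_le[OF kappa_in_MIc] kappa_inv_kappa assms(2) by metis
qed

lemma extremal_chain_kappaI:
  fixes X :: "'a set"
  assumes "maximal_chain X"
    and dichotomy: "\<And>x j. x \<in> X \<Longrightarrow> j \<in> JIc \<Longrightarrow> \<not> j \<le> x \<Longrightarrow> x \<le> kappa j"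
  shows "extremal_chain kappa X"
proof -
  have "(\<exists>!j. j \<in> JIc \<and> j \<le> y \<and> \<not> j \<le> x) \<and>
        (\<exists>!m. m \<in> MIc \<and> x \<le> m \<and> \<not> y \<le> m) \<and>
        (\<forall>j m. j \<in> JIc \<and> j \<le> y \<and> \<not> j \<le> x \<longrightarrow> m \<in> MIc \<and> x \<le> m \<and> \<not> y \<le> m \<longrightarrow> kappa j = m)"
    if X: "x \<in> X" "y \<in> X" and cov: "covers x y" for x y
  proof -
    obtain j where j: "j \<in> JIc" "j \<le> y" "\<not> j \<le> x"
      using cov exists_JIc_le_not_le[of y x] unfolding covers_def by (auto simp: less_le_not_le)
    have j_unique: "i = j" if "i \<in> JIc" "i \<le> y" "\<not> i \<le> x" for i
      using that j JIc_label_le[OF cov] dichotomy[OF X(1)] by (meson order.antisym)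
    have m_unique: "m = kappa j" if m: "m \<in> MIc" "x \<le> m" "\<not> y \<le> m" for m
    proof -
      \<comment> \<open>The dichotomy at \<open>y\<close>, rather than at \<open>x\<close>, puts \<open>\<kappa>\<^sup>-\<^sup>1(m)\<close> below \<open>y\<close>.\<close>
      have "kappa_inv m \<le> y"
        using dichotomy[OF X(2) kappa_inv_in_JIc] kappa_kappa_inv m by metis
      moreover have "\<not> kappa_inv m \<le> x"
        using not_le_kappa[OF kappa_inv_in_JIc] kappa_kappa_inv m by (metis order_trans)
      ultimately have "kappa_inv m = j"
        using j_unique kappa_inv_in_JIc m(1) by blast
      then show ?thesis
        using kappa_kappa_inv m(1) by metis
    qed
    have kj: "kappa j \<in> MIc" "x \<le> kappa j" "\<not> y \<le> kappa j"
      using kappa_in_MIc[OF j(1)] dichotomy[OF X(1) j(1,3)] not_le_kappa[OF j(1)] j(2)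
      by (simp, simp, metis order_trans)
    show ?thesis
      using j kj j_unique m_unique by blast
  qed
  then show ?thesis
    unfolding extremal_chain_def using assms by blast
qed

lemma left_modular_iff_extremal_if_separated:
  assumes "\<And>x y :: 'a. x < y \<Longrightarrow> \<exists>j\<in>JIc. j \<le> y \<and> x \<le> kappa j"
  shows "left_modular TYPE('a) \<longleftrightarrow> extremal TYPE('a)"
proof
  assume "left_modular TYPE('a)"
  then obtain X :: "'a set" where "maximal_chain X" "\<forall>x\<in>X. left_modular_element x"
    unfolding left_modular_def by blast
  then have "extremal_chain kappa X"
    by (blast intro: extremal_chain_kappaI left_modular_element_imp_le_kappa)
  then show "extremal TYPE('a)"
    unfolding extremal_def using kappa_bij by blast
next
  assume "extremal TYPE('a)"
  then obtain l and X :: "'a set"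
    where "\<forall>j\<in>JIc. l j = kappa j" "extremal_chain l X"
    unfolding extremal_def using kappa_lattice by blast
  then have "maximal_chain X" "\<And>x j. x \<in> X \<Longrightarrow> j \<in> JIc \<Longrightarrow> \<not> j \<le> x \<Longrightarrow> x \<le> kappa j"
    unfolding extremal_chain_def by auto
  then show "left_modular TYPE('a)"
    unfolding left_modular_def using left_modular_elementI_kappa[OF assms] by blast
qed

end

section \<open>Completely semidistributive lattices\<close>

context
  assumes csd: "completely_semidistributive TYPE('a::complete_lattice)"
begin

lemma sup_Inf_solutions:
  assumes "sup (u::'a) a = v"
  shows "sup u (Inf {w. sup u w = v}) = v"
proof -
  let ?S = "{w. sup u w = v}"
  have "(\<forall>y\<in>?S. \<forall>z\<in>?S. sup u y = sup u z) \<longrightarrow> (\<forall>y\<in>?S. sup u (Inf ?S) = sup u y)"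
    using csd unfolding completely_semidistributive_def by blast
  then have "sup u (Inf ?S) = sup u a"
    using assms by auto
  then show ?thesis
    using assms by (rule trans)
qed

lemma inf_Sup_solutions:
  assumes "inf (v::'a) a = u"
  shows "inf v (Sup {w. inf v w = u}) = u"
proof -
  let ?S = "{w. inf v w = u}"
  have "(\<forall>y\<in>?S. \<forall>z\<in>?S. inf v y = inf v z) \<longrightarrow> (\<forall>y\<in>?S. inf v (Sup ?S) = inf v y)"
    using csd unfolding completely_semidistributive_def by blast
  then have "inf v (Sup ?S) = inf v a"
    using assms by auto
  then show ?thesis
    using assms by (rule trans)
qed

text \<open>The least solution of \<open>u \<squnion> w = v\<close> is completely join-irreducible: joining anything
  strictly below it with \<open>u\<close> falls short of \<open>v\<close>, so stays at \<open>u\<close>.\<close>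

lemma cover_least_JIc:
  assumes "covers (u::'a) v"
  obtains j where "j \<in> JIc" and "sup u j = v" and "\<And>w. sup u w = v \<Longrightarrow> j \<le> w"
    and "lower_star j \<le> u"
proof
  define j where "j = Inf {w. sup u w = v}"
  have uv: "u < v" and cov: "\<And>z. u < z \<Longrightarrow> \<not> z < v"
    using assms unfolding covers_def by auto
  show join: "sup u j = v"
    unfolding j_def using uv by (intro sup_Inf_solutions[of u v]) (simp add: sup.absorb2)
  show least: "j \<le> w" if "sup u w = v" for w
    unfolding j_def using that by (simp add: Inf_lower)
  have below: "w \<le> u" if "w < j" for w
  proof -
    have "sup u w \<le> v"
      using that join by (metis less_imp_le order_refl sup.mono)
    moreover have "sup u w \<noteq> v"
      using that least leD by blast
    ultimately have "sup u w = u"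
      using cov by (metis order_le_less sup_ge1)
    then show ?thesis
      by (simp add: sup.absorb_iff1)
  qed
  have "\<not> j \<le> u"
    using join uv by (auto simp: sup.absorb1)
  then show "j \<in> JIc"
    using below by (rule JIc_if_separated)
  show "lower_star j \<le> u"
    unfolding lower_star_def using below by (auto intro: Sup_least)
qed

lemma cover_greatest_MIc:
  assumes "covers (u::'a) v"
  obtains m where "m \<in> MIc" and "inf v m = u" and "\<And>w. inf v w = u \<Longrightarrow> w \<le> m"
proof
  define m where "m = Sup {w. inf v w = u}"
  have uv: "u < v" and cov: "\<And>z. u < z \<Longrightarrow> \<not> z < v"
    using assms unfolding covers_def by auto
  show meet: "inf v m = u"
    unfolding m_def using uv by (intro inf_Sup_solutions[of v u]) (simp add: inf.absorb2)
  show greatest: "w \<le> m" if "inf v w = u" for w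
    unfolding m_def using that by (simp add: Sup_upper)
  have above: "v \<le> w" if "m < w" for w
  proof -
    have "u \<le> inf v w"
      using that meet by (metis inf.mono less_imp_le order_refl)
    moreover have "inf v w \<noteq> u"
      using that greatest leD by blast
    ultimately have "inf v w = v"
      using cov by (metis order_le_less inf_le1)
    then show ?thesis
      by (simp add: inf.absorb_iff1)
  qed
  have "\<not> v \<le> m"
    using meet uv by (auto simp: inf.absorb1)
  then show "m \<in> MIc"
    using above by (rule MIc_if_separated)
qed

text \<open>The elements meeting \<open>j\<close> in \<open>j\<^sub>*\<close> are the solutions attached to the cover
  \<open>j\<^sub>* \<lessdot> j\<close>, so \<open>\<kappa>(j)\<close> exists and is completely meet-irreducible.\<close>

lemma csd_kappa:
  assumes "(j::'a) \<in> JIc"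
  shows "kappa j \<in> MIc" and "inf (kappa j) j = lower_star j"
    and "\<And>y. inf y j = lower_star j \<Longrightarrow> y \<le> kappa j"
proof -
  obtain m where m: "m \<in> MIc" "inf m j = lower_star j" "\<And>w. inf w j = lower_star j \<Longrightarrow> w \<le> m"
    using cover_greatest_MIc[OF covers_lower_star[OF assms]] by (metis inf.commute)
  from m(2,3) have "kappa j = m"
    by (rule kappa_eqI)
  then show "kappa j \<in> MIc" "inf (kappa j) j = lower_star j"
    "\<And>y. inf y j = lower_star j \<Longrightarrow> y \<le> kappa j"
    by (simp_all only: m)
qed

lemma csd_kappa_inv:
  assumes "(m::'a) \<in> MIc"
  shows "kappa_inv m \<in> JIc" and "sup (kappa_inv m) m = upper_star m"
    and "\<And>y. sup y m = upper_star m \<Longrightarrow> kappa_inv m \<le> y"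
proof -
  obtain j where j: "j \<in> JIc" "sup j m = upper_star m" "\<And>w. sup w m = upper_star m \<Longrightarrow> j \<le> w"
    using cover_least_JIc[OF covers_upper_star[OF assms]] by (metis sup.commute)
  from j(2,3) have "kappa_inv m = j"
    by (rule kappa_inv_eqI)
  then show "kappa_inv m \<in> JIc" "sup (kappa_inv m) m = upper_star m"
    "\<And>y. sup y m = upper_star m \<Longrightarrow> kappa_inv m \<le> y"
    by (simp_all only: j)
qed

text \<open>Maximality of \<open>m = \<kappa>(j)\<close> gives \<open>j \<le> m\<^sup>*\<close>, hence \<open>j \<squnion> m = m\<^sup>*\<close> and
  \<open>\<kappa>\<^sup>-\<^sup>1(m) \<le> j\<close>. The inequality is not strict, since everything strictly below \<open>j\<close> is
  below \<open>j\<^sub>* \<le> m\<close> and so has join \<open>m\<close> with \<open>m\<close>.\<close>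

lemma csd_kappa_inv_kappa:
  assumes j: "(j::'a) \<in> JIc"
  shows "kappa_inv (kappa j) = j"
proof -
  define m where "m = kappa j"
  have m: "m \<in> MIc" "inf m j = lower_star j"
    and m_max: "\<And>y. inf y j = lower_star j \<Longrightarrow> y \<le> m"
    unfolding m_def using csd_kappa[OF j] by blast+
  have star: "lower_star j \<le> m" "m < upper_star m"
    using m less_upper_star by (metis inf_le1, blast)
  have "j \<le> upper_star m"
  proof (rule ccontr)
    assume "\<not> ?thesis"
    then have "inf (upper_star m) j = lower_star j"
      using j star by (intro inf_eq_lower_starI) auto
    then show False
      using m_max star(2) leD by blast
  qed
  moreover have "\<not> j \<le> m"
    using m(2) lower_star_less[OF j] by (auto simp: inf.absorb2)
  ultimately have "sup j m = upper_star m"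
    using upper_star_le[of m "sup j m"] star(2)
    by (metis le_supI order.antisym order_le_less sup.cobounded1 sup.cobounded2)
  then have "kappa_inv m \<le> j"
    using csd_kappa_inv(3)[OF m(1)] by blast
  moreover have "\<not> kappa_inv m < j"
  proof
    assume "kappa_inv m < j"
    then have "kappa_inv m \<le> m"
      using le_lower_star star(1) order_trans by blast
    then show False
      using csd_kappa_inv(2)[OF m(1)] star(2) by (simp add: sup.absorb2)
  qed
  ultimately show ?thesis
    unfolding m_def by simp
qed

text \<open>Dually, minimality of \<open>j = \<kappa>\<^sup>-\<^sup>1(m)\<close> gives \<open>j\<^sub>* \<le> m\<close>, hence \<open>m \<le> \<kappa>(j)\<close>;
  everything strictly above \<open>m\<close> is above \<open>m\<^sup>* \<ge> j\<close>.\<close>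

lemma csd_kappa_kappa_inv:
  assumes m: "(m::'a) \<in> MIc"
  shows "kappa (kappa_inv m) = m"
proof -
  define j where "j = kappa_inv m"
  have j: "j \<in> JIc" "sup j m = upper_star m"
    and j_min: "\<And>y. sup y m = upper_star m \<Longrightarrow> j \<le> y"
    unfolding j_def using csd_kappa_inv[OF m] by blast+
  have star: "j \<le> upper_star m" "lower_star j < j" "m < upper_star m"
    using j lower_star_less less_upper_star m by (metis sup_ge1, blast+)
  have "lower_star j \<le> m"
  proof (rule ccontr)
    assume *: "\<not> ?thesis"
    have "sup (lower_star j) m = upper_star m"
    proof (rule order.antisym)
      show "sup (lower_star j) m \<le> upper_star m"
        using star by (meson le_supI less_imp_le order_trans)
      show "upper_star m \<le> sup (lower_star j) m"
        using * by (intro upper_star_le) (metis order_le_less sup.cobounded1 sup.cobounded2)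
    qed
    then show False
      using j_min star(2) leD by blast
  qed
  moreover have "\<not> j \<le> m"
    using j(2) star(3) by (auto simp: sup.absorb2)
  ultimately have "inf m j = lower_star j"
    using j(1) by (intro inf_eq_lower_starI)
  then have "m \<le> kappa j"
    using csd_kappa(3)[OF j(1)] by blast
  moreover have "\<not> m < kappa j"
  proof
    assume "m < kappa j"
    then have "j \<le> kappa j"
      using upper_star_le star(1) order_trans by blast
    then show False
      using csd_kappa(2)[OF j(1)] star(2) by (simp add: inf.absorb2)
  qed
  ultimately show ?thesis
    unfolding j_def by simp
qed

text \<open>A cover \<open>u \<lessdot> v\<close> between \<open>x\<close> and \<open>y\<close> is separated by the least \<open>j\<close> with \<open>u \<squnion> j = v\<close>:
  as \<open>j\<^sub>* \<le> u\<close> and \<open>j \<not>\<le> u\<close>, the meet of \<open>u\<close> and \<open>j\<close> is \<open>j\<^sub>*\<close>, so \<open>u \<le> \<kappa>(j)\<close>.\<close>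

lemma weakly_atomic_csd_separated:
  assumes "weakly_atomic TYPE('a)" and "(x::'a) < y"
  shows "\<exists>j\<in>JIc. j \<le> y \<and> x \<le> kappa j"
proof -
  obtain u v where uv: "x \<le> u" "covers u v" "v \<le> y"
    using assms unfolding weakly_atomic_def by blast
  obtain j where j: "j \<in> JIc" "sup u j = v" "lower_star j \<le> u"
    using cover_least_JIc[OF uv(2)] by metis
  have "\<not> j \<le> u"
    using j(2) uv(2) unfolding covers_def by (auto simp: sup.absorb1)
  then have "u \<le> kappa j"
    using j csd_kappa(3) inf_eq_lower_starI by blast
  then show ?thesis
    using j uv by (metis order_trans sup_ge2)
qed

lemma weakly_atomic_csd_bi_spatial:
  assumes "weakly_atomic TYPE('a)"
  shows "bi_spatial TYPE('a)"
  unfolding bi_spatial_def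
proof (intro allI conjI)
  note separated = weakly_atomic_csd_separated[OF assms]
  have irrefl: "\<not> j \<le> kappa j" if "j \<in> JIc" for j :: 'a
    using csd_kappa(2)[OF that] lower_star_less[OF that] by (auto simp: inf.absorb2)
  fix x :: 'a
  \<comment> \<open>If the join of the irreducibles below \<open>x\<close> were smaller than \<open>x\<close>, a separating \<open>j\<close> would
    occur in that join, and hence lie below \<open>\<kappa>(j)\<close>. Dually for meets, with \<open>\<kappa>(j)\<close>.\<close>
  have "x = Sup {j\<in>JIc. j \<le> x}"
  proof (rule ccontr)
    let ?s = "Sup {j\<in>JIc. j \<le> x}"
    assume "x \<noteq> ?s"
    moreover have "?s \<le> x"
      by (auto intro: Sup_least)
    ultimately obtain j where "j \<in> JIc" "j \<le> x" "?s \<le> kappa j"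
      using separated[of ?s x] by force
    then show False
      using irrefl by (auto simp: Sup_le_iff)
  qed
  then show "\<exists>S. S \<subseteq> JIc \<and> x = Sup S"
    by (intro exI[of _ "{j\<in>JIc. j \<le> x}"]) auto
  have "x = Inf {m\<in>MIc. x \<le> m}"
  proof (rule ccontr)
    let ?s = "Inf {m\<in>MIc. x \<le> m}"
    assume "x \<noteq> ?s"
    moreover have "x \<le> ?s"
      by (auto intro: Inf_greatest)
    ultimately obtain j where "j \<in> JIc" "j \<le> ?s" "x \<le> kappa j"
      using separated[of x ?s] by force
    then show False
      using irrefl csd_kappa(1) by (auto simp: le_Inf_iff)
  qed
  then show "\<exists>S. S \<subseteq> MIc \<and> x = Inf S"
    by (intro exI[of _ "{m\<in>MIc. x \<le> m}"]) auto
qed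

lemma weakly_atomic_csd_kappa_lattice:
  assumes "weakly_atomic TYPE('a)"
  shows "kappa_lattice TYPE('a)"
proof -
  note inverse = csd_kappa_inv_kappa csd_kappa_kappa_inv
  have "bij_betw kappa (JIc :: 'a set) MIc"
    using inverse csd_kappa(1) csd_kappa_inv(1) by (intro bij_betw_byWitness[of _ kappa_inv]) auto
  moreover have "bij_betw kappa_inv (MIc :: 'a set) JIc"
    using inverse csd_kappa(1) csd_kappa_inv(1) by (intro bij_betw_byWitness[of _ kappa]) auto
  moreover have "\<forall>j\<in>(JIc :: 'a set). \<exists>x. inf x j = lower_star j \<and>
      (\<forall>y. inf y j = lower_star j \<longrightarrow> y \<le> x)"
    using csd_kappa(2,3) by blast
  moreover have "\<forall>m\<in>(MIc :: 'a set). \<exists>y. sup y m = upper_star m \<and>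
      (\<forall>z. sup z m = upper_star m \<longrightarrow> y \<le> z)"
    using csd_kappa_inv(2,3) by blast
  ultimately show ?thesis
    unfolding kappa_lattice_def using inverse weakly_atomic_csd_bi_spatial[OF assms] by simp
qed

end

section \<open>Left modularity is equivalent to extremality\<close>

theorem theorem1p1:
  "(well_separated_kappa_lattice TYPE('a::complete_lattice) \<longrightarrow>
      (left_modular TYPE('a) \<longleftrightarrow> extremal TYPE('a))) \<and>
   (weakly_atomic TYPE('a) \<and> completely_semidistributive TYPE('a) \<longrightarrow>
      (left_modular TYPE('a) \<longleftrightarrow> extremal TYPE('a)))"
proof (intro conjI impI)
  assume "well_separated_kappa_lattice TYPE('a)"
  then have "kappa_lattice TYPE('a)"
    and "\<And>x y :: 'a. x < y \<Longrightarrow> \<exists>j\<in>JIc. j \<le> y \<and> x \<le> kappa j"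
    unfolding well_separated_kappa_lattice_def by (auto simp: less_le_not_le)
  then show "left_modular TYPE('a) \<longleftrightarrow> extremal TYPE('a)"
    by (rule left_modular_iff_extremal_if_separated)
next
  assume "weakly_atomic TYPE('a) \<and> completely_semidistributive TYPE('a)"
  then have wa: "weakly_atomic TYPE('a)" and csd: "completely_semidistributive TYPE('a)"
    by auto
  show "left_modular TYPE('a) \<longleftrightarrow> extremal TYPE('a)"
    using weakly_atomic_csd_kappa_lattice[OF csd wa] weakly_atomic_csd_separated[OF csd wa]
    by (rule left_modular_iff_extremal_if_separated)
qed

end
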